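(* Let $G$ be any finite connected graph with $N_s$ vertices, let $U,J>0$, and let $$H_{\mathrm{exact}}=U\sum_{\bm R}(1-P_{\bm R})+J\sum_{\langle\bm R\bm R'\rangle}h_{\bm R\bm R'}$$ act on the full fermionic Fock space of $4N_s$ modes. Then for each $0\le M\le N_s$ the state $|\Psi_M\rangle$ is (up to a scalar) the unique zero mode (vector annihilated by $H_{\mathrm{exact}}$) in the sector with total electron number $N_e=4M$. Across all charge sectors the zero-energy ground space is $$\mathcal G=\operatorname{span}\{|\Psi_M\rangle:0\le M\le N_s\},\qquad \dim\mathcal G=N_s+1,$$ and no sector with electron number not divisible by four contains a zero mode.
   Context: The vertices $\bm R$ of $G$ label cells; each cell carries four fermionic modes with creation operators $c_{\bm R,m}^\dagger$, $m=1,\dots,4$ (canonical anticommutation relations), vacuum $|0\rangle$, and number operators $\hat n_{\bm R,m}=c_{\bm R,m}^\dagger c_{\bm R,m}$. The total electron number is $N_e=\sum_{\bm R,m}\hat n_{\bm R,m}$. Define $q_{\bm R}^\dagger=c_{\bm R,1}^\dagger c_{\bm R,2}^\dagger c_{\bm R,3}^\dagger c_{\bm R,4}^\dagger$ and $q_{\bm R}=(q_{\bm R}^\dagger)^\dagger$. Define the projectors $P_{\bm R}^{(0)}=\prod_m(1-\hat n_{\bm R,m})$, $P_{\bm R}^{(4)}=\prod_m\hat n_{\bm R,m}$, $P_{\bm R}=P_{\bm R}^{(0)}+P_{\bm R}^{(4)}$. For each edge $\langle\bm R\bm R'\rangle$ of $G$, $$h_{\bm R\bm R'}=\tfrac12\left[P_{\bm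 R}^{(4)}P_{\bm R'}^{(0)}+P_{\bm R}^{(0)}P_{\bm R'}^{(4)}-q_{\bm R}^\dagger q_{\bm R'}-q_{\bm R'}^\dagger q_{\bm R}\right].$$ The uniform $M$-quartet state is $$|\Psi_M\rangle=\frac{1}{M!\sqrt{\binom{N_s}{M}}}\Big(\sum_{\bm R}q_{\bm R}^\dagger\Big)^M|0\rangle .$$ *)

theory Defs
  imports "HOL-Analysis.Analysis" "Graph_Theory.Graph_Theory"
begin

(* A mode is a pair (R, m) of a cell R and a flavour m = 1, 2, 3, 4. In the four-element type 4 the
   numeral 4 denotes the same element as 0, so 1, 2, 3, 4 are exactly its four distinct elements. *)
type_synonym 'v mode = "'v \<times> 4"

(* The Fock space has one orthonormal basis vector for each set of occupied modes. *)
type_synonym 'v fock = "complex ^ ('v mode set)"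

(* Products of operators are written **, and the identity is mat 1; the operations *, 1 and ^
   that come with the type vec are entrywise and are not used on operators. *)
type_synonym 'v operator = "complex ^ ('v mode set) ^ ('v mode set)"

definition adj :: "complex ^ 'a ^ 'b \<Rightarrow> complex ^ 'b ^ 'a" where
  "adj A = (\<chi> i j. cnj (A $ j $ i))"

(* The basis vector of the occupied set {m1, ..., mk}, listed so that pos m1 < ... < pos mk,
   stands for the state cdag m1 ... cdag mk |0>. The injection pos fixes these
   (otherwise arbitrary) signs. *)
definition jw_sign :: "('v::finite mode \<Rightarrow> nat) \<Rightarrow> 'v mode \<Rightarrow> 'v mode set \<Rightarrow> complex" where
  "jw_sign pos m S = (- 1) ^ card {k \<in> S. pos k < pos m}"

definition cdag :: "('v::finite mode \<Rightarrow> nat) \<Rightarrow> 'v mode \<Rightarrow> 'v operator" where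
  "cdag pos m = (\<chi> T S. if m \<notin> S \<and> T = insert m S then jw_sign pos m S else 0)"

definition cann :: "('v::finite mode \<Rightarrow> nat) \<Rightarrow> 'v mode \<Rightarrow> 'v operator" where
  "cann pos m = adj (cdag pos m)"

definition vacuum :: "'v::finite fock" where
  "vacuum = axis {} 1"

definition num :: "('v::finite mode \<Rightarrow> nat) \<Rightarrow> 'v mode \<Rightarrow> 'v operator" where
  "num pos m = cdag pos m ** cann pos m"

definition total_num :: "('v::finite mode \<Rightarrow> nat) \<Rightarrow> 'v operator" where
  "total_num pos = (\<Sum>m\<in>UNIV. num pos m)"

definition qdag :: "('v::finite mode \<Rightarrow> nat) \<Rightarrow> 'v \<Rightarrow> 'v operator" where
  "qdag pos R = cdag pos (R, 1) ** cdag pos (R, 2) ** cdag pos (R, 3) ** cdag pos (R, 4)"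

definition qann :: "('v::finite mode \<Rightarrow> nat) \<Rightarrow> 'v \<Rightarrow> 'v operator" where
  "qann pos R = adj (qdag pos R)"

definition P0 :: "('v::finite mode \<Rightarrow> nat) \<Rightarrow> 'v \<Rightarrow> 'v operator" where
  "P0 pos R = (mat 1 - num pos (R, 1)) ** (mat 1 - num pos (R, 2))
     ** (mat 1 - num pos (R, 3)) ** (mat 1 - num pos (R, 4))"

definition P4 :: "('v::finite mode \<Rightarrow> nat) \<Rightarrow> 'v \<Rightarrow> 'v operator" where
  "P4 pos R = num pos (R, 1) ** num pos (R, 2) ** num pos (R, 3) ** num pos (R, 4)"

definition Pcell :: "('v::finite mode \<Rightarrow> nat) \<Rightarrow> 'v \<Rightarrow> 'v operator" where
  "Pcell pos R = P0 pos R + P4 pos R"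

definition bond :: "('v::finite mode \<Rightarrow> nat) \<Rightarrow> 'v \<Rightarrow> 'v \<Rightarrow> 'v operator" where
  "bond pos R R' = (1/2) *\<^sub>R
     (P4 pos R ** P0 pos R' + P0 pos R ** P4 pos R'
      - qdag pos R ** qann pos R' - qdag pos R' ** qann pos R)"

(* An undirected edge {R, R'} of a pair_graph is the pair of arcs (R, R') and (R', R), and
   bond pos R R' = bond pos R' R (lemma bond_commute), so half the sum over the arcs is the
   sum over the undirected edges. *)
definition H_exact ::
  "'v::finite pair_pre_digraph \<Rightarrow> ('v mode \<Rightarrow> nat) \<Rightarrow> real \<Rightarrow> real \<Rightarrow> 'v operator" where
  "H_exact G pos U J =
     U *\<^sub>R (\<Sum>R\<in>pverts G. mat 1 - Pcell pos R)
     + J *\<^sub>R ((1/2) *\<^sub>R (\<Sum>(R, R')\<in>parcs G. bond pos R R'))"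

definition quartet_state :: "('v::finite mode \<Rightarrow> nat) \<Rightarrow> nat \<Rightarrow> 'v fock" where
  "quartet_state pos M =
     (1 / (fact M * sqrt (real (CARD('v) choose M)))) *\<^sub>R
     (((\<lambda>\<psi>. (\<Sum>R\<in>UNIV. qdag pos R) *v \<psi>) ^^ M) vacuum)"

definition sector :: "('v::finite mode \<Rightarrow> nat) \<Rightarrow> nat \<Rightarrow> 'v fock set" where
  "sector pos N = {\<psi>. total_num pos *v \<psi> = of_nat N *s \<psi>}"

definition zero_modes ::
  "'v::finite pair_pre_digraph \<Rightarrow> ('v mode \<Rightarrow> nat) \<Rightarrow> real \<Rightarrow> real \<Rightarrow> 'v fock set" where
  "zero_modes G pos U J = {\<psi>. H_exact G pos U J *v \<psi> = 0}"


lemma flavours: "(UNIV :: 4 set) = {1, 2, 3, 4}" "distinct [1, 2, 3, 4 :: 4]"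
  using exhaust_4 by auto

lemma matrix_vector_mult_axis: "A *v axis S 1 = column S (A :: complex ^ 'n ^ 'm)"
  by (simp add: vec_eq_iff matrix_vector_mult_def column_def axis_def if_distrib cong: if_cong)

lemma operator_eqI:
  fixes A B :: "complex ^ 'n ^ 'm"
  assumes "\<And>S. A *v axis S 1 = B *v axis S 1"
  shows "A = B"
  using assms by (simp add: matrix_vector_mult_axis column_def vec_eq_iff)

lemma cdag_axis:
  "cdag pos m *v axis S 1 = (if m \<in> S then 0 else jw_sign pos m S *s axis (insert m S) 1)"
  unfolding matrix_vector_mult_axis by (simp add: column_def cdag_def vec_eq_iff axis_def)

lemma cann_axis:
  "cann pos m *v axis S 1 = (if m \<in> S then jw_sign pos m (S - {m}) *s axis (S - {m}) 1 else 0)"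
proof -
  have *: "m \<notin> T \<and> S = insert m T \<longleftrightarrow> m \<in> S \<and> T = S - {m}" for T
    by blast
  have "cann pos m $ T $ S = (if m \<in> S \<and> T = S - {m} then jw_sign pos m T else 0)" for T
    unfolding cann_def adj_def cdag_def by (simp add: * jw_sign_def)
  then show ?thesis
    unfolding matrix_vector_mult_axis by (simp add: column_def vec_eq_iff axis_def)
qed

lemma jw_sign_insert:
  assumes "m \<noteq> k" "k \<notin> S"
  shows "jw_sign pos m (insert k S) = (if pos k < pos m then - jw_sign pos m S else jw_sign pos m S)"
proof -
  have "{j \<in> insert k S. pos j < pos m} =
      (if pos k < pos m then insert k {j \<in> S. pos j < pos m} else {j \<in> S. pos j < pos m})"
    by auto
  then show ?thesis
    using assms by (simp add: jw_sign_def)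
qed

lemma jw_sign_remove:
  assumes "m \<noteq> k" "k \<in> S"
  shows "jw_sign pos m (S - {k}) = (if pos k < pos m then - jw_sign pos m S else jw_sign pos m S)"
  using jw_sign_insert[of m k "S - {k}" pos] assms by (simp add: insert_absorb split: if_splits)

lemma jw_sign_square [simp]: "jw_sign pos m S * jw_sign pos m S = 1"
  by (simp add: jw_sign_def flip: power_add mult_2)

lemma CAR_create_create:
  assumes "inj pos"
  shows "cdag pos m ** cdag pos k + cdag pos k ** cdag pos m = 0"
proof (rule operator_eqI)
  fix S :: "'a mode set"
  have sq: "cdag pos k ** cdag pos k = 0"
    by (rule operator_eqI) (simp add: cdag_axis vec.scale flip: matrix_vector_mul_assoc)
  have "pos m < pos k \<or> pos k < pos m" if "m \<noteq> k"
    using assms that by (metis injD linorder_neqE_nat)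
  then consider "m = k" | "m \<noteq> k" "pos m < pos k" | "m \<noteq> k" "pos k < pos m"
    by blast
  then show "(cdag pos m ** cdag pos k + cdag pos k ** cdag pos m) *v axis S 1 = 0 *v axis S 1"
    by cases (simp add: sq, simp_all add: matrix_vector_mult_add_rdistrib cdag_axis vec.scale jw_sign_insert
        insert_commute mult.commute flip: matrix_vector_mul_assoc)
qed

lemma CAR_annihilate_create:
  assumes "inj pos"
  shows "cann pos m ** cdag pos k + cdag pos k ** cann pos m = (if m = k then mat 1 else 0)"
proof (rule operator_eqI)
  fix S :: "'a mode set"
  have "pos m < pos k \<or> pos k < pos m" if "m \<noteq> k"
    using assms that by (metis injD linorder_neqE_nat)
  then consider "m = k" | "m \<noteq> k" "pos m < pos k" | "m \<noteq> k" "pos k < pos m"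
    by blast
  then show "(cann pos m ** cdag pos k + cdag pos k ** cann pos m) *v axis S 1
      = (if m = k then mat 1 else 0) *v axis S 1"
    by cases (simp_all add: matrix_vector_mult_add_rdistrib cdag_axis cann_axis vec.scale
        insert_absorb insert_Diff_if jw_sign_insert jw_sign_remove mult.commute
        flip: matrix_vector_mul_assoc)
qed

lemma vacuum_annihilated: "cann pos m *v vacuum = 0"
  by (simp add: vacuum_def cann_axis)

lemma num_axis: "num pos m *v axis S 1 = (if m \<in> S then axis S 1 else 0)"
  by (auto simp: num_def cdag_axis cann_axis vec.scale insert_absorb
      simp flip: matrix_vector_mul_assoc)

lemma P0_axis:
  "P0 pos R *v axis S 1 = (if (R, 1) \<in> S \<or> (R, 2) \<in> S \<or> (R, 3) \<in> S \<or> (R, 4) \<in> S then 0 else axis S 1)"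
  by (simp add: P0_def num_axis matrix_vector_mult_diff_rdistrib flip: matrix_vector_mul_assoc)

lemma P4_axis:
  "P4 pos R *v axis S 1 = (if (R, 1) \<in> S \<and> (R, 2) \<in> S \<and> (R, 3) \<in> S \<and> (R, 4) \<in> S then axis S 1 else 0)"
  by (simp add: P4_def num_axis flip: matrix_vector_mul_assoc)

lemma P0_P4_commute: "P0 pos R ** P4 pos R' = P4 pos R' ** P0 pos R"
  by (rule operator_eqI) (simp add: P0_axis P4_axis flip: matrix_vector_mul_assoc)

lemma bond_commute: "bond pos R R' = bond pos R' R"
  by (simp add: bond_def P0_P4_commute algebra_simps)

end

theory Submission
  imports Defs
begin

text \<open>
  The operators \<open>1 - P\<^sub>R\<close> and the bond operators are orthogonal projections, so \<open>H\<close> is positive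
  semidefinite and its kernel is the intersection of their kernels. The cell projections force a zero
  mode to be supported on unions of full cells; a bond forces the amplitude, corrected by the
  sign of \<open>\<Prod> q\<^sup>\<dagger>\<close> on the vacuum, to be unchanged when one quartet moves along the edge.
  Moving quartets along paths of the connected graph links any two sets of cells of equal size, so the
  amplitude depends only on the number of quartets.
\<close>

section \<open>Orthogonal projections\<close>

lemma matrix_scaleR_vector:
  fixes A :: "'a::real_algebra_1 ^ 'n ^ 'm"
  shows "(k *\<^sub>R A) *v x = k *\<^sub>R (A *v x)"
  by (simp add: vec_eq_iff matrix_vector_mult_def scaleR_sum_right)

lemma matrix_sum_vector: "(\<Sum>i\<in>I. A i) *v x = (\<Sum>i\<in>I. A i *v x)"
  by (induction I rule: infinite_finite_induct) (simp_all add: matrix_vector_mult_add_rdistrib)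

lemma matrix_entry: "(A :: complex ^ 'n ^ 'm) $ T $ S = (A *v axis S 1) $ T"
  by (simp add: matrix_vector_mult_axis column_def)

lemma adj_adj: "adj (adj A) = A"
  by (simp add: adj_def vec_eq_iff)

lemma adj_mult: "adj (A ** B) = adj B ** adj A"
  by (simp add: adj_def matrix_matrix_mult_def vec_eq_iff mult.commute)

lemma adj_add: "adj (A + B) = adj A + adj B"
  by (simp add: adj_def vec_eq_iff)

lemma adj_diff: "adj (A - B) = adj A - adj B"
  by (simp add: adj_def vec_eq_iff)

lemma adj_scaleR: "adj (k *\<^sub>R A) = k *\<^sub>R adj A"
  by (simp add: adj_def vec_eq_iff)

text \<open>The Hermitian form, conjugate-linear in the first argument. Its values are complex,
  unlike those of \<open>inner\<close>, so pairing an eigenvector with its image determines the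
  whole eigenvalue and shows that it is real.\<close>

definition cinner :: "complex ^ 'n \<Rightarrow> complex ^ 'n \<Rightarrow> complex" where
  "cinner x y = (\<Sum>i\<in>UNIV. cnj (x $ i) * y $ i)"

lemma cinner_add_right: "cinner x (y + z) = cinner x y + cinner x z"
  by (simp add: cinner_def distrib_left sum.distrib)

lemma cinner_scaleR_right: "cinner x (k *\<^sub>R y) = of_real k * cinner x y"
  unfolding cinner_def sum_distrib_left vector_scaleR_component by (simp add: scaleR_conv_of_real mult_ac)

lemma cinner_scale_right: "cinner x (k *s y) = k * cinner x y"
  by (simp add: cinner_def sum_distrib_left mult_ac)

lemma cinner_sum_right: "cinner x (\<Sum>i\<in>I. f i) = (\<Sum>i\<in>I. cinner x (f i))"
  by (simp add: cinner_def sum_distrib_left sum.swap[of _ I])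

lemma cinner_self: "cinner x x = of_real ((norm x)\<^sup>2)"
proof -
  have "cnj z * z = of_real ((cmod z)\<^sup>2)" for z :: complex
    by (metis complex_norm_square mult.commute)
  then have "cinner x x = of_real (\<Sum>i\<in>UNIV. (cmod (x $ i))\<^sup>2)"
    by (simp add: cinner_def)
  then show ?thesis
    by (simp add: norm_vec_def L2_set_def sum_nonneg)
qed

lemma cinner_adj: "cinner x (A *v y) = cinner (adj A *v x) y"
  by (simp add: cinner_def matrix_vector_mult_def adj_def sum_distrib_left sum_distrib_right
      sum.swap[of _ "UNIV :: 'b set"] mult_ac)

text \<open>Replace \<open>B\<close> by \<open>B ** B\<close> and move one factor to the left
  argument. This is the source of all positivity below.\<close>

lemma cinner_projection:
  assumes "adj B = B" "B ** B = B"
  shows "cinner x (B *v x) = of_real ((norm (B *v x))\<^sup>2)"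
  by (metis assms cinner_adj cinner_self matrix_vector_mul_assoc)

section \<open>Action of the operators on amplitudes\<close>

definition cells :: "'v set \<Rightarrow> 'v mode set" where
  "cells A = A \<times> UNIV"

lemma cells_insert: "cells (insert R A) = cells A \<union> cells {R}"
  by (auto simp: cells_def)

lemma cell_disjoint_iff:
  "cells {R} \<inter> S = {} \<longleftrightarrow> \<not> ((R, 1) \<in> S \<or> (R, 2) \<in> S \<or> (R, 3) \<in> S \<or> (R, 4) \<in> S)"
  by (auto simp: cells_def flavours)

lemma cell_subset_iff:
  "cells {R} \<subseteq> S \<longleftrightarrow> (R, 1) \<in> S \<and> (R, 2) \<in> S \<and> (R, 3) \<in> S \<and> (R, 4) \<in> S"
  by (auto simp: cells_def flavours)

text \<open>The accumulated sign of the four creation operators of a cell. The rightmost one,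
  flavour 4, acts first, so each later factor sees the modes already inserted.\<close>

definition qsign :: "('v::finite mode \<Rightarrow> nat) \<Rightarrow> 'v \<Rightarrow> 'v mode set \<Rightarrow> complex" where
  "qsign pos R S = jw_sign pos (R, 4) S * jw_sign pos (R, 3) (insert (R, 4) S)
     * jw_sign pos (R, 2) (insert (R, 3) (insert (R, 4) S))
     * jw_sign pos (R, 1) (insert (R, 2) (insert (R, 3) (insert (R, 4) S)))"

lemma qsign_square [simp]: "qsign pos R S * qsign pos R S = 1"
proof -
  have *: "(a * b * c * d) * (a * b * c * d) = (a * a) * (b * b) * (c * c) * (d * d)" for a b c d :: complex
    by algebra
  show ?thesis
    by (simp only: qsign_def *) simp
qed

lemma cnj_qsign [simp]: "cnj (qsign pos R S) = qsign pos R S"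
  by (simp add: qsign_def jw_sign_def)

lemma qdag_axis:
  "qdag pos R *v axis S 1 =
     (if cells {R} \<inter> S = {} then qsign pos R S *s axis (S \<union> cells {R}) 1 else 0)"
proof -
  have "S \<union> cells {R} = insert (R, 1) (insert (R, 2) (insert (R, 3) (insert (R, 4) S)))"
    by (auto simp: cells_def flavours)
  then show ?thesis
    using flavours(2)
    by (auto simp: cell_disjoint_iff qdag_def cdag_axis vec.scale qsign_def mult_ac
        simp flip: matrix_vector_mul_assoc)
qed

lemma qdag_entry:
  "qdag pos R $ T $ S = (if cells {R} \<inter> S = {} \<and> T = S \<union> cells {R} then qsign pos R S else 0)"
  unfolding matrix_entry qdag_axis by (auto simp: axis_def)

text \<open>Only one basis set, \<open>T - cells {R}\<close>, is mapped to \<open>T\<close>. Reading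
  amplitudes backwards in this way lets products of operators be evaluated entry by entry.\<close>

lemma qdag_apply:
  "(qdag pos R *v \<psi>) $ T =
     (if cells {R} \<subseteq> T then qsign pos R (T - cells {R}) * \<psi> $ (T - cells {R}) else 0)"
proof -
  have *: "cells {R} \<inter> S = {} \<and> T = S \<union> cells {R} \<longleftrightarrow> cells {R} \<subseteq> T \<and> S = T - cells {R}" for S
    by auto
  show ?thesis
    by (simp add: matrix_vector_mult_def qdag_entry * if_distrib[of "\<lambda>x. x * _"] cong: if_cong)
qed

lemma qann_apply:
  "(qann pos R *v \<psi>) $ T =
     (if cells {R} \<inter> T = {} then qsign pos R T * \<psi> $ (T \<union> cells {R}) else 0)"
  by (simp add: matrix_vector_mult_def qann_def adj_def qdag_entry
      if_distrib[of cnj] if_distrib[of "\<lambda>x. x * _"] cong: if_cong)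

lemma P0_entry: "P0 pos R $ T $ S = (if T = S \<and> cells {R} \<inter> S = {} then 1 else 0)"
  unfolding matrix_entry P0_axis cell_disjoint_iff by (auto simp: axis_def)

lemma P4_entry: "P4 pos R $ T $ S = (if T = S \<and> cells {R} \<subseteq> S then 1 else 0)"
  unfolding matrix_entry P4_axis cell_subset_iff by (auto simp: axis_def)

lemma P0_apply: "(P0 pos R *v \<psi>) $ T = (if cells {R} \<inter> T = {} then \<psi> $ T else 0)"
proof -
  have "T = S \<and> cells {R} \<inter> S = {} \<longleftrightarrow> cells {R} \<inter> T = {} \<and> S = T" for S by auto
  then show ?thesis
    by (simp add: matrix_vector_mult_def P0_entry if_distrib[of "\<lambda>x. x * _"] cong: if_cong)
qed

lemma P4_apply: "(P4 pos R *v \<psi>) $ T = (if cells {R} \<subseteq> T then \<psi> $ T else 0)"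
proof -
  have "T = S \<and> cells {R} \<subseteq> S \<longleftrightarrow> cells {R} \<subseteq> T \<and> S = T" for S by auto
  then show ?thesis
    by (simp add: matrix_vector_mult_def P4_entry if_distrib[of "\<lambda>x. x * _"] cong: if_cong)
qed

lemma total_num_apply: "(total_num pos *v \<psi>) $ T = of_nat (card T) * \<psi> $ T"
proof -
  have "num pos m $ T $ S = (if S = T then if m \<in> T then 1 else 0 else 0)" for m S
    unfolding matrix_entry num_axis by (auto simp: axis_def)
  then have "(num pos m *v \<psi>) $ T = (if m \<in> T then \<psi> $ T else 0)" for m
    by (simp add: matrix_vector_mult_def if_distrib[of "\<lambda>x. x * _"] cong: if_cong)
  then show ?thesis
    by (simp add: total_num_def matrix_sum_vector flip: sum.inter_filter)
qed

lemma cell_subset_not_disjoint: "cells {R} \<subseteq> T \<Longrightarrow> cells {R} \<inter> T \<noteq> {}"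
  by (auto simp: cells_def)

lemma Pcell_apply:
  "((mat 1 - Pcell pos R) *v \<psi>) $ T = (if cells {R} \<inter> T = {} \<or> cells {R} \<subseteq> T then 0 else \<psi> $ T)"
  using cell_subset_not_disjoint[of R T]
  by (simp add: Pcell_def matrix_vector_mult_add_rdistrib matrix_vector_mult_diff_rdistrib P0_apply P4_apply)

text \<open>At such an \<open>S\<close> two of the four terms survive: the diagonal term with
  \<open>R\<close> full and \<open>R'\<close> empty, and the hop into \<open>R\<close> from the
  configuration with \<open>R'\<close> full instead.\<close>

lemma bond_apply_full_empty:
  assumes "cells {R} \<subseteq> S" "cells {R'} \<inter> S = {}"
  shows "(bond pos R R' *v \<psi>) $ S =
     (\<psi> $ S - qsign pos R (S - cells {R}) * qsign pos R' (S - cells {R}) * \<psi> $ (S - cells {R} \<union> cells {R'})) / 2"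
proof -
  have "cells {R} \<inter> S \<noteq> {}" "\<not> cells {R'} \<subseteq> S" "cells {R'} \<inter> (S - cells {R}) = {}"
    using assms cell_subset_not_disjoint[of R S] cell_subset_not_disjoint[of R' S] by auto
  then show ?thesis
    using assms
    unfolding bond_def matrix_scaleR_vector vector_scaleR_component
    by (simp add: matrix_vector_mult_add_rdistrib matrix_vector_mult_diff_rdistrib P0_apply P4_apply
        qdag_apply qann_apply flip: matrix_vector_mul_assoc)
      (simp add: scaleR_conv_of_real)
qed

text \<open>Every term of the bond needs one cell full and the other empty. Distinctness matters:
  for equal cells the hopping terms give \<open>- P4 pos R\<close>, which is not a
  projection.\<close>

lemma bond_apply_eq_0:
  assumes "R \<noteq> R'" "\<not> (cells {R} \<subseteq> S \<and> cells {R'} \<inter> S = {})" "\<not> (cells {R'} \<subseteq> S \<and> cells {R} \<inter> S = {})"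
  shows "(bond pos R R' *v \<psi>) $ S = 0"
proof -
  have "cells {R} \<inter> cells {R'} = {}"
    using assms(1) by (auto simp: cells_def)
  \<comment> \<open>The hopping terms test emptiness after the other cell has been removed; for
    disjoint cells this is the same test as on \<open>S\<close>.\<close>
  then have e: "cells {R'} \<inter> (S - cells {R}) = {} \<longleftrightarrow> cells {R'} \<inter> S = {}"
    "cells {R} \<inter> (S - cells {R'}) = {} \<longleftrightarrow> cells {R} \<inter> S = {}"
    by auto
  from assms(2,3) show ?thesis
    by (cases "cells {R} \<subseteq> S"; cases "cells {R'} \<subseteq> S")
      (simp_all add: bond_def matrix_scaleR_vector matrix_vector_mult_add_rdistrib e
        matrix_vector_mult_diff_rdistrib P0_apply P4_apply qdag_apply qann_apply
      flip: matrix_vector_mul_assoc)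
qed

section \<open>Cell and bond operators are orthogonal projections\<close>

lemma adj_P0: "adj (P0 pos R) = P0 pos R"
  by (auto simp: adj_def vec_eq_iff P0_entry)

lemma adj_P4: "adj (P4 pos R) = P4 pos R"
  by (auto simp: adj_def vec_eq_iff P4_entry)

lemma adj_one: "adj (mat 1) = mat 1"
  by (auto simp: adj_def vec_eq_iff mat_def)

lemma operator_eqI_apply:
  fixes A B :: "complex ^ 'n ^ 'm"
  assumes "\<And>\<psi> T. (A *v \<psi>) $ T = (B *v \<psi>) $ T"
  shows "A = B"
  by (rule operator_eqI) (simp add: vec_eq_iff assms)

lemma Pcell_projection:
  "adj (mat 1 - Pcell pos R) = mat 1 - Pcell pos R"
  "(mat 1 - Pcell pos R) ** (mat 1 - Pcell pos R) = mat 1 - Pcell pos R"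
  by (simp add: Pcell_def adj_diff adj_add adj_P0 adj_P4 adj_one)
    (rule operator_eqI_apply, simp add: Pcell_apply flip: matrix_vector_mul_assoc)

lemma adj_bond: "adj (bond pos R R') = bond pos R R'"
  by (simp add: bond_def adj_scaleR adj_add adj_diff adj_mult adj_P0 adj_P4 adj_adj qann_def
      P0_P4_commute algebra_simps)

text \<open>On the amplitudes at \<open>S\<close> and at its partner \<open>S'\<close>, with the
  quartet moved to \<open>R'\<close>, the bond is the 2 by 2 matrix with diagonal entries 1/2 and
  off-diagonal entries - s/2. Here s = \<open>a * b\<close> is a sign, so s squared is 1 and the
  matrix is idempotent.\<close>

lemma bond_idempotent_full_empty:
  assumes "R \<noteq> R'" "cells {R} \<subseteq> S" "cells {R'} \<inter> S = {}"
  shows "(bond pos R R' *v (bond pos R R' *v \<psi>)) $ S = (bond pos R R' *v \<psi>) $ S"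
proof -
  let ?B = "bond pos R R'"
  \<comment> \<open>The common background of \<open>S\<close> and \<open>S'\<close>, with both cells
    empty; both signs are evaluated on it.\<close>
  define T where "T = S - cells {R}"
  define S' where "S' = T \<union> cells {R'}"
  define a where "a = qsign pos R T"
  define b where "b = qsign pos R' T"
  have "cells {R} \<inter> cells {R'} = {}"
    using assms by (auto simp: cells_def)
  then have "cells {R'} \<subseteq> S'" "cells {R} \<inter> S' = {}" "S' - cells {R'} = T" "T \<union> cells {R} = S"
    using assms(2,3) by (auto simp: S'_def T_def)
  then have S': "(?B *v \<psi>) $ S' = (\<psi> $ S' - b * a * \<psi> $ S) / 2"
    using bond_apply_full_empty[of R' S' R pos \<psi>] by (simp add: a_def b_def bond_commute[of pos R])
  have S: "(?B *v \<phi>) $ S = (\<phi> $ S - a * b * \<phi> $ S') / 2" for \<phi>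
    using bond_apply_full_empty[OF assms(2,3), of pos \<phi>] by (simp add: T_def S'_def a_def b_def)
  have "((x - a * b * y) / 2 - a * b * ((y - b * a * x) / 2)) / 2 = (x - a * b * y) / 2" for x y
  proof -
    have "a * a = 1" "b * b = 1"
      by (simp_all add: a_def b_def)
    then have "a * b * (b * a * x) = x"
      by algebra
    then show ?thesis
      by (simp add: field_simps)
  qed
  then show ?thesis
    by (simp only: S[of "?B *v \<psi>"] S[of \<psi>] S')
qed

lemma bond_idempotent:
  assumes "R \<noteq> R'"
  shows "bond pos R R' ** bond pos R R' = bond pos R R'"
proof (rule operator_eqI_apply)
  fix \<psi> :: "'a fock" and S
  let ?B = "bond pos R R'"
  consider (1) "cells {R} \<subseteq> S" "cells {R'} \<inter> S = {}" | (2) "cells {R'} \<subseteq> S" "cells {R} \<inter> S = {}"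
    | (3) "\<not> (cells {R} \<subseteq> S \<and> cells {R'} \<inter> S = {})" "\<not> (cells {R'} \<subseteq> S \<and> cells {R} \<inter> S = {})"
    by blast
  then have "(?B *v (?B *v \<psi>)) $ S = (?B *v \<psi>) $ S"
  proof cases
    case 1
    then show ?thesis
      using assms by (intro bond_idempotent_full_empty)
  next
    case 2
    then show ?thesis
      unfolding bond_commute[of pos R R'] using assms by (intro bond_idempotent_full_empty) simp_all
  next
    case 3
    then show ?thesis
      by (simp add: bond_apply_eq_0[OF assms])
  qed
  then show "((?B ** ?B) *v \<psi>) $ S = (?B *v \<psi>) $ S"
    by (simp flip: matrix_vector_mul_assoc)
qed

section \<open>Quartet states\<close>

lemma qdag_vector:
  "qdag pos R *v \<psi> = cdag pos (R, 1) *v (cdag pos (R, 2) *v (cdag pos (R, 3) *v (cdag pos (R, 4) *v \<psi>)))"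
  by (simp add: qdag_def flip: matrix_vector_mul_assoc)

text \<open>A quartet operator is a product of an even number of anticommuting factors, so it
  commutes with every creation operator.\<close>

lemma qdag_commute:
  assumes "inj pos"
  shows "qdag pos R *v (qdag pos R' *v \<psi>) = qdag pos R' *v (qdag pos R *v \<psi>)"
proof -
  have anti: "cdag pos m *v (cdag pos k *v \<phi>) = - (cdag pos k *v (cdag pos m *v \<phi>))" for m k \<phi>
  proof -
    have "cdag pos m *v (cdag pos k *v \<phi>) + cdag pos k *v (cdag pos m *v \<phi>) = 0 *v \<phi>"
      unfolding CAR_create_create[OF assms, of m k, symmetric]
      by (simp add: matrix_vector_mult_add_rdistrib flip: matrix_vector_mul_assoc)
    then show ?thesis
      by (simp add: eq_neg_iff_add_eq_0)
  qed
  \<comment> \<open>Passing four creation operators produces four minus signs, which cancel.\<close>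
  have "cdag pos m *v (qdag pos R' *v \<phi>) = qdag pos R' *v (cdag pos m *v \<phi>)" for m \<phi>
    by (simp add: qdag_vector anti[of m] vec.neg)
  then show ?thesis
    by (simp add: qdag_vector[of pos R])
qed

text \<open>The product of the quartet operators over \<open>A\<close>, applied to the vacuum. By
  \<open>qdag_commute\<close> the order is irrelevant for injective \<open>pos\<close>, which makes
  a fold over a set appropriate.\<close>

definition quartets :: "('v::finite mode \<Rightarrow> nat) \<Rightarrow> 'v set \<Rightarrow> 'v fock" where
  "quartets pos A = Finite_Set.fold (\<lambda>R \<psi>. qdag pos R *v \<psi>) vacuum A"

text \<open>The sign between the physical product state and the basis vector with the same occupied
  modes. It records how \<open>pos\<close> orders the modes.\<close>

definition qcoeff :: "('v::finite mode \<Rightarrow> nat) \<Rightarrow> 'v set \<Rightarrow> complex" where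
  "qcoeff pos A = quartets pos A $ cells A"

lemma cells_disjoint_iff [simp]: "cells {R} \<inter> cells A = {} \<longleftrightarrow> R \<notin> A"
  by (auto simp: cells_def)

lemma cell_subset_cells_iff [simp]: "cells {R} \<subseteq> cells A \<longleftrightarrow> R \<in> A"
  by (auto simp: cells_def)

lemma cells_eq_iff [simp]: "cells A = cells B \<longleftrightarrow> A = B"
  by (auto simp: cells_def)

lemma cells_diff: "cells A - cells B = cells (A - B)"
  by (auto simp: cells_def)

lemma card_cells: "card (cells A) = 4 * card A"
  by (simp add: cells_def card_cartesian_product)

lemma quartets_empty [simp]: "quartets pos {} = vacuum"
  by (simp add: quartets_def)

lemma quartets_insert:
  assumes "inj pos" "R \<notin> A"
  shows "quartets pos (insert R A) = qdag pos R *v quartets pos A"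
proof -
  interpret comp_fun_commute "\<lambda>R \<psi>. qdag pos R *v \<psi>"
    by unfold_locales (simp add: fun_eq_iff qdag_commute[OF assms(1)])
  show ?thesis
    unfolding quartets_def using assms(2) by (intro fold_insert) simp_all
qed

lemma quartets_eq_qcoeff:
  assumes "inj pos"
  shows "quartets pos A = qcoeff pos A *s axis (cells A) 1" "qcoeff pos A * qcoeff pos A = 1"
proof -
  \<comment> \<open>The induction is run with an unnamed sign; evaluating at \<open>cells A\<close>
    afterwards identifies it as \<open>qcoeff pos A\<close>.\<close>
  have "\<exists>c. c * c = 1 \<and> quartets pos A = c *s axis (cells A) 1"
  proof (induction A rule: finite_induct[OF finite])
    case 1
    show ?case
      by (intro exI[of _ 1]) (simp add: vacuum_def cells_def)
  next
    case (2 R A)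
    then obtain c where c: "c * c = 1" "quartets pos A = c *s axis (cells A) 1"
      by blast
    have "(c * qsign pos R (cells A)) * (c * qsign pos R (cells A)) = 1"
      using c(1) qsign_square[of pos R "cells A"] by algebra
    moreover have "quartets pos (insert R A) = (c * qsign pos R (cells A)) *s axis (cells (insert R A)) 1"
      using 2 by (simp add: quartets_insert[OF assms] c vec.scale qdag_axis cells_insert[of R A])
    ultimately show ?case
      by blast
  qed
  then obtain c where "c * c = 1" "quartets pos A = c *s axis (cells A) 1"
    by blast
  then show "quartets pos A = qcoeff pos A *s axis (cells A) 1" "qcoeff pos A * qcoeff pos A = 1"
    by (simp_all add: qcoeff_def)
qed

lemma qcoeff_insert:
  assumes "inj pos" "R \<notin> A"
  shows "qcoeff pos (insert R A) = qsign pos R (cells A) * qcoeff pos A"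
  using assms cells_insert[of R A]
  by (simp add: qcoeff_def[of _ "insert R A"] quartets_insert quartets_eq_qcoeff(1)[OF assms(1), of A]
      vec.scale qdag_axis)

text \<open>The quartet state without normalisation: each set of \<open>M\<close> cells occurs once.
  For \<open>M\<close> above the number of cells the sum is empty and the state is 0.\<close>

definition uniform_state :: "('v::finite mode \<Rightarrow> nat) \<Rightarrow> nat \<Rightarrow> 'v fock" where
  "uniform_state pos M = (\<Sum>A | card A = M. quartets pos A)"

lemma uniform_state_cells:
  assumes "inj pos"
  shows "uniform_state pos M $ cells A = (if card A = M then qcoeff pos A else 0)"
proof -
  have *: "quartets pos B $ cells A = (if B = A then qcoeff pos A else 0)" for B
    by (subst quartets_eq_qcoeff(1)[OF assms]) (auto simp: axis_def)
  show ?thesis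
    unfolding uniform_state_def sum_component * by simp
qed

text \<open>Different \<open>M\<close> live on sets of different size, so a single amplitude
  isolates a single coefficient, up to sign. Both the expansion of zero modes and linear
  independence rest on this.\<close>

lemma sum_uniform_state_cells:
  fixes pos :: "'v::finite mode \<Rightarrow> nat"
  assumes "inj pos"
  shows "(\<Sum>M\<le>CARD('v). a M *s uniform_state pos M) $ cells A = a (card A) * qcoeff pos A"
  by (simp add: uniform_state_cells[OF assms] if_distrib card_mono cong: if_cong)

lemma uniform_state_not_cells:
  assumes "inj pos" "\<And>A. S \<noteq> cells A"
  shows "uniform_state pos M $ S = 0"
  by (simp add: uniform_state_def quartets_eq_qcoeff(1)[OF assms(1)] axis_def assms(2))

text \<open>A set of \<open>M + 1\<close> cells arises from a set of \<open>M\<close> cells in \<open>M + 1\<close> ways, and \<open>q\<^sup>\<dagger>\<close> vanishes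
  on a full cell.\<close>

lemma sum_qdag_uniform_state:
  assumes "inj pos"
  shows "(\<Sum>R\<in>UNIV. qdag pos R) *v uniform_state pos M = of_nat (Suc M) *s uniform_state pos (Suc M)"
proof -
  have q: "qdag pos R *v quartets pos A = (if R \<notin> A then quartets pos (insert R A) else 0)" for R A
    by (simp add: quartets_insert[OF assms])
      (simp add: quartets_eq_qcoeff(1)[OF assms] vec.scale qdag_axis)
  have "(\<Sum>R\<in>UNIV. qdag pos R) *v uniform_state pos M
      = (\<Sum>A | card A = M. \<Sum>R | R \<notin> A. quartets pos (insert R A))"
    by (simp add: matrix_sum_vector uniform_state_def vec.sum q sum.swap[of _ UNIV] flip: sum.inter_filter)
  also have "\<dots> = (\<Sum>(A, R)\<in>(SIGMA A:{A. card A = M}. {R. R \<notin> A}). quartets pos (insert R A))"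
    by (simp add: sum.Sigma)
  also have "\<dots> = (\<Sum>(B, R)\<in>(SIGMA B:{B. card B = Suc M}. B). quartets pos B)"
    by (rule sum.reindex_bij_witness[of _ "\<lambda>(B, R). (B - {R}, R)" "\<lambda>(A, R). (insert R A, R)"])
      (auto simp: insert_absorb)
  also have "\<dots> = (\<Sum>B | card B = Suc M. \<Sum>R\<in>B. quartets pos B)"
    by (rule sum.Sigma[symmetric]) auto
  also have "\<dots> = of_nat (Suc M) *s uniform_state pos (Suc M)"
  proof -
    have "(\<Sum>R\<in>B. v) = of_nat (card B) *s v" for B :: "'a set" and v :: "'a fock"
      by (simp only: vec_eq_iff sum_component vector_smult_component) simp
    then show ?thesis
      by (simp only: uniform_state_def vec.scale_sum_right) (rule sum.cong, auto)
  qed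
  finally show ?thesis .
qed

lemma quartet_state_eq_uniform_state:
  fixes pos :: "'v::finite mode \<Rightarrow> nat"
  assumes "inj pos" "M \<le> CARD('v)"
  shows "\<exists>c. c \<noteq> 0 \<and> quartet_state pos M = c *s uniform_state pos M"
proof (intro exI conjI)
  \<comment> \<open>The successive raisings contribute the factors 1, ..., \<open>M\<close>, which
    the prefactor of \<open>quartet_state\<close> cancels.\<close>
  have "((\<lambda>\<psi>. (\<Sum>R\<in>UNIV. qdag pos R) *v \<psi>) ^^ M) vacuum = fact M *s uniform_state pos M"
  proof (induction M)
    case 0
    then show ?case by (simp add: uniform_state_def)
  next
    case (Suc M)
    then show ?case
      by (simp add: vec.scale sum_qdag_uniform_state[OF assms(1)] mult.commute del: of_nat_Suc)
  qed
  then show "quartet_state pos M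
      = complex_of_real (fact M / (fact M * sqrt (real (CARD('v) choose M)))) *s uniform_state pos M"
    unfolding quartet_state_def vec_eq_iff vector_scaleR_component by (simp add: scaleR_conv_of_real)
  \<comment> \<open>The bound on \<open>M\<close> keeps the binomial coefficient positive; otherwise
    the division would yield 0.\<close>
  show "complex_of_real (fact M / (fact M * sqrt (real (CARD('v) choose M)))) \<noteq> 0"
    using assms(2) by simp
qed

section \<open>Zero modes\<close>

lemma H_exact_vector:
  "H_exact G pos U J *v \<psi> = U *\<^sub>R (\<Sum>R\<in>pverts G. (mat 1 - Pcell pos R) *v \<psi>)
     + (J / 2) *\<^sub>R (\<Sum>(R, R')\<in>parcs G. bond pos R R' *v \<psi>)"
  by (simp add: H_exact_def matrix_vector_mult_add_rdistrib matrix_scaleR_vector matrix_sum_vector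
      case_prod_unfold)

text \<open>Each summand is a projection, so its expectation is a squared norm. The factor
  \<open>J / 2\<close> compensates for counting both arcs of an edge; absence of loops makes every
  bond in the sum a projection.\<close>

lemma cinner_H_exact:
  assumes "irrefl (parcs G)"
  shows "cinner \<psi> (H_exact G pos U J *v \<psi>) = complex_of_real
    (U * (\<Sum>R\<in>pverts G. (norm ((mat 1 - Pcell pos R) *v \<psi>))\<^sup>2)
     + J / 2 * (\<Sum>(R, R')\<in>parcs G. (norm (bond pos R R' *v \<psi>))\<^sup>2))"
proof -
  have "cinner \<psi> (bond pos (fst e) (snd e) *v \<psi>) = of_real ((norm (bond pos (fst e) (snd e) *v \<psi>))\<^sup>2)"
    if "e \<in> parcs G" for e
    using assms that by (intro cinner_projection adj_bond bond_idempotent) (metis irreflD prod.collapse)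
  then show ?thesis
    by (simp add: H_exact_vector cinner_add_right cinner_scaleR_right cinner_sum_right case_prod_unfold
        cinner_projection[OF Pcell_projection])
qed

lemma zero_mode_iff:
  assumes "irrefl (parcs G)" "U > 0" "J > 0"
  shows "H_exact G pos U J *v \<psi> = 0 \<longleftrightarrow>
    (\<forall>R\<in>pverts G. (mat 1 - Pcell pos R) *v \<psi> = 0) \<and> (\<forall>(R, R')\<in>parcs G. bond pos R R' *v \<psi> = 0)"
    (is "_ \<longleftrightarrow> ?R")
proof
  assume "H_exact G pos U J *v \<psi> = 0"
  then have "complex_of_real
    (U * (\<Sum>R\<in>pverts G. (norm ((mat 1 - Pcell pos R) *v \<psi>))\<^sup>2)
     + J / 2 * (\<Sum>(R, R')\<in>parcs G. (norm (bond pos R R' *v \<psi>))\<^sup>2)) = 0"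
    unfolding cinner_H_exact[OF assms(1), symmetric] by (simp add: cinner_def)
  then have "U * (\<Sum>R\<in>pverts G. (norm ((mat 1 - Pcell pos R) *v \<psi>))\<^sup>2)
     + J / 2 * (\<Sum>(R, R')\<in>parcs G. (norm (bond pos R R' *v \<psi>))\<^sup>2) = 0"
    by (simp only: of_real_eq_0_iff)
  moreover have "(\<Sum>R\<in>pverts G. (norm ((mat 1 - Pcell pos R) *v \<psi>))\<^sup>2) \<ge> 0"
    "(\<Sum>(R, R')\<in>parcs G. (norm (bond pos R R' *v \<psi>))\<^sup>2) \<ge> 0"
    by (auto intro!: sum_nonneg)
  ultimately have "(\<Sum>R\<in>pverts G. (norm ((mat 1 - Pcell pos R) *v \<psi>))\<^sup>2) = 0"
    "(\<Sum>(R, R')\<in>parcs G. (norm (bond pos R R' *v \<psi>))\<^sup>2) = 0"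
    using assms(2,3) by (auto simp: add_nonneg_eq_0_iff)
  then show ?R
    by (auto simp: sum_nonneg_eq_0_iff case_prod_unfold)
next
  assume ?R
  then show "H_exact G pos U J *v \<psi> = 0"
    unfolding H_exact_vector by (auto simp: case_prod_unfold intro!: sum.neutral)
qed

text \<open>The eigenvalue is the Rayleigh quotient of its eigenvector. With this bound, zero modes
  are ground states and not merely a kernel.\<close>

lemma H_eigenvalue_nonneg:
  assumes "irrefl (parcs G)" "U \<ge> 0" "J \<ge> 0"
    and "\<psi> \<noteq> 0" "H_exact G pos U J *v \<psi> = \<epsilon> *s \<psi>"
  shows "\<epsilon> \<in> \<real>\<^sub>\<ge>\<^sub>0"
proof -
  define E where "E = U * (\<Sum>R\<in>pverts G. (norm ((mat 1 - Pcell pos R) *v \<psi>))\<^sup>2)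
     + J / 2 * (\<Sum>(R, R')\<in>parcs G. (norm (bond pos R R' *v \<psi>))\<^sup>2)"
  have "E \<ge> 0"
    using assms(2,3) unfolding E_def
    by (intro add_nonneg_nonneg mult_nonneg_nonneg sum_nonneg) auto
  have "\<epsilon> * of_real ((norm \<psi>)\<^sup>2) = of_real E"
    using cinner_H_exact[OF assms(1), of \<psi> pos U J] unfolding assms(5) E_def cinner_scale_right cinner_self .
  then have "\<epsilon> = of_real (E / (norm \<psi>)\<^sup>2)"
    using assms(4) by (simp add: eq_divide_eq)
  then show ?thesis
    using \<open>E \<ge> 0\<close> by (simp add: nonneg_Reals_of_real_iff)
qed

section \<open>Moving quartets between sets of cells\<close>

lemma move_along_path:
  assumes "(x, z) \<in> E\<^sup>*"
    and edge: "\<And>x y A. (x, y) \<in> E \<Longrightarrow> x \<in> A \<Longrightarrow> y \<notin> A \<Longrightarrow> g (insert y (A - {x})) = g A"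
    and "x \<in> A" "z \<notin> A"
  shows "g (insert z (A - {x})) = g A"
  using assms(1,3,4)
proof (induction arbitrary: A rule: rtrancl_induct)
  case base
  then show ?case by blast
next
  case (step y z)
  consider "y = x" | "y = z" | "y \<noteq> x" "y \<noteq> z" "y \<notin> A" | "y \<noteq> x" "y \<noteq> z" "y \<in> A"
    by blast
  then show ?case
  proof cases
    \<comment> \<open>The intermediate cell is free: move from \<open>x\<close> to \<open>y\<close>
      first, then across the last edge to \<open>z\<close>.\<close>
    case 3
    have "insert z (insert y (A - {x}) - {y}) = insert z (A - {x})"
      using 3 by auto
    then show ?thesis
      using step 3 edge[of y z "insert y (A - {x})"] by auto
  next
    \<comment> \<open>The intermediate cell is occupied: its own quartet goes to \<open>z\<close>
      first, and the one at \<open>x\<close> then refills \<open>y\<close>. Only the resulting set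
      matters.\<close>
    case 4
    have "insert y (insert z (A - {y}) - {x}) = insert z (A - {x})"
      using 4 step.prems by auto
    then show ?thesis
      using step.IH[of "insert z (A - {y})"] step 4 edge[of y z A] by auto
  qed (use step edge in auto)
qed

text \<open>Exchanging an element of \<open>A - B\<close> for one of \<open>B - A\<close> lowers
  \<open>card (A - B)\<close> by one; equal cardinalities ensure that the second difference is
  nonempty whenever the first is.\<close>

lemma card_invariant_if_swap_invariant:
  fixes g :: "'v::finite set \<Rightarrow> 'b"
  assumes swap: "\<And>x y A. x \<in> A \<Longrightarrow> y \<notin> A \<Longrightarrow> g (insert y (A - {x})) = g A"
    and "card A = card B"
  shows "g A = g B"
  using assms(2)
proof (induction "card (A - B)" arbitrary: A)
  case 0
  then show ?case
    by (metis card_0_eq card_subset_eq Diff_eq_empty_iff finite)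
next
  case (Suc n)
  then obtain x where x: "x \<in> A" "x \<notin> B"
    by (metis Diff_iff card_gt_0_iff ex_in_conv zero_less_Suc)
  have "card (B - A) = card (A - B)"
    using Suc.prems card_Diff_subset_Int[of B A] card_Diff_subset_Int[of A B] by (simp add: Int_commute)
  then obtain y where y: "y \<in> B" "y \<notin> A"
    using Suc.hyps(2) by (metis Diff_iff card_gt_0_iff ex_in_conv zero_less_Suc)
  have "insert y (A - {x}) - B = (A - B) - {x}"
    using y by auto
  then have "n = card (insert y (A - {x}) - B)"
    using Suc.hyps(2) x by simp
  moreover have "card (insert y (A - {x})) = card B"
    using Suc.prems x y card_Suc_Diff1[of A x] by (metis Diff_iff card_insert_disjoint finite)
  ultimately show ?case
    using Suc.hyps(1) swap[OF x(1) y(2)] by metis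
qed

section \<open>Expansion of zero modes in uniform states\<close>

lemma eq_cells_if_full_or_empty:
  assumes "\<And>R. cells {R} \<inter> S = {} \<or> cells {R} \<subseteq> S"
  shows "S = cells {R. cells {R} \<subseteq> S}"
  using assms by (fastforce simp: cells_def)

text \<open>Some cell is partially filled in \<open>S\<close>, and
  \<open>mat 1 - Pcell pos R\<close> for that cell leaves the amplitude at \<open>S\<close>
  unchanged.\<close>

lemma vanishes_off_cells:
  assumes "\<And>R. (mat 1 - Pcell pos R) *v \<psi> = 0" "\<And>A. S \<noteq> cells A"
  shows "\<psi> $ S = 0"
proof -
  obtain R where "\<not> (cells {R} \<inter> S = {} \<or> cells {R} \<subseteq> S)"
    using eq_cells_if_full_or_empty[of S] assms(2) by blast
  then show ?thesis
    using Pcell_apply[of pos R \<psi> S] by (simp add: assms(1))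
qed

lemma zero_mode_expansion:
  fixes \<psi> :: "'v::finite fock"
  assumes "inj pos"
    and P: "\<And>R. (mat 1 - Pcell pos R) *v \<psi> = 0"
    and B: "\<And>R R'. (R, R') \<in> E \<Longrightarrow> R \<noteq> R' \<and> bond pos R R' *v \<psi> = 0"
    and conn: "\<And>x y. (x, y) \<in> E\<^sup>*"
  obtains a where "\<psi> = (\<Sum>M\<le>CARD('v). a M *s uniform_state pos M)"
proof -
  \<comment> \<open>Multiplication by \<open>qcoeff\<close> removes the ordering sign, so that the
    bond condition becomes plain invariance under a move.\<close>
  define g where "g A = qcoeff pos A * \<psi> $ cells A" for A
  have edge: "g (insert y (A - {x})) = g A" if "(x, y) \<in> E" "x \<in> A" "y \<notin> A" for x y A
  proof -
    define C where "C = A - {x}"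
    have A: "A = insert x C" "x \<notin> C" "y \<notin> C" "x \<noteq> y"
      using that B by (auto simp: C_def)
    have "\<psi> $ cells A = qsign pos x (cells C) * qsign pos y (cells C) * \<psi> $ cells (insert y C)"
      using B[OF that(1)] bond_apply_full_empty[of x "cells A" y pos \<psi>] that(2,3) cells_insert[of y C]
      by (simp add: cells_diff flip: C_def)
    \<comment> \<open>Here \<open>a\<close> and \<open>b\<close> are the signs of adding
      \<open>x\<close> and \<open>y\<close> to \<open>C\<close>, \<open>q\<close> is
      \<open>qcoeff pos C\<close>, and \<open>p\<close> is the amplitude after the move.\<close>
    moreover have "(a * q) * (a * b * p) = b * q * p" if "a * a = 1" for a b p q :: complex
      using that by algebra
    ultimately show ?thesis
      using A unfolding C_def[symmetric] g_def
      by (simp add: qcoeff_insert[OF assms(1)])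
  qed
  have inv: "g A = g B" if "card A = card B" for A B
    by (rule card_invariant_if_swap_invariant[OF move_along_path[OF conn edge] that])
  \<comment> \<open>By \<open>inv\<close> every set of \<open>M\<close> cells gives the same value,
    so any representative serves.\<close>
  define a where "a M = g (SOME A. card A = M)" for M
  have a: "g A = a (card A)" for A
    unfolding a_def by (rule inv, rule sym, rule someI[of "\<lambda>B. card B = card A"]) simp
  have "\<psi> $ S = (\<Sum>M\<le>CARD('v). a M *s uniform_state pos M) $ S" for S
  proof (cases "\<exists>A. S = cells A")
    case True
    then obtain A where A: "S = cells A" ..
    have "(\<Sum>M\<le>CARD('v). a M *s uniform_state pos M) $ S = a (card A) * qcoeff pos A"
      unfolding A by (rule sum_uniform_state_cells[OF assms(1)])
    also have "\<dots> = \<psi> $ S"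
      unfolding a[symmetric] g_def A using quartets_eq_qcoeff(2)[OF assms(1), of A] by algebra
    finally show ?thesis by simp
  next
    case False
    then show ?thesis
      using vanishes_off_cells[OF P] uniform_state_not_cells[OF assms(1)] by simp
  qed
  then show thesis
    using that[of a] by (simp add: vec_eq_iff)
qed

section \<open>Uniform states are zero modes\<close>

lemma uniform_state_Pcell:
  assumes "inj pos"
  shows "(mat 1 - Pcell pos R) *v uniform_state pos M = 0"
proof -
  have "((mat 1 - Pcell pos R) *v uniform_state pos M) $ S = 0" for S
    using uniform_state_not_cells[OF assms, of S M] unfolding Pcell_apply by fastforce
  then show ?thesis
    by (simp add: vec_eq_iff)
qed

text \<open>Adding either cell to a union of cells gives equally many cells and two signs over the
  same background. If \<open>T\<close> is no union of cells, neither is \<open>T\<close> with a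
  further full cell, and both amplitudes vanish.\<close>

lemma uniform_state_swap:
  assumes "inj pos" "cells {R} \<inter> T = {}" "cells {R'} \<inter> T = {}"
  shows "uniform_state pos M $ (T \<union> cells {R}) = qsign pos R T * qsign pos R' T * uniform_state pos M $ (T \<union> cells {R'})"
proof (cases "\<exists>C. T = cells C")
  case True
  then obtain C where C: "T = cells C" ..
  have "(a * b) * (b * q) = a * q" if "b * b = 1" for a b q :: complex
    using that by algebra
  then show ?thesis
    using assms by (simp add: C uniform_state_cells qcoeff_insert flip: cells_insert)
next
  case False
  have "T \<union> cells {Q} \<noteq> cells A" if "cells {Q} \<inter> T = {}" for Q A
  proof
    assume "T \<union> cells {Q} = cells A"
    then have "T = cells (A - {Q})"
      using that by (simp flip: cells_diff) blast
    then show False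
      using False by blast
  qed
  then show ?thesis
    using assms by (simp add: uniform_state_not_cells)
qed

lemma uniform_state_bond_full_empty:
  assumes "inj pos" "cells {R} \<subseteq> S" "cells {R'} \<inter> S = {}"
  shows "(bond pos R R' *v uniform_state pos M) $ S = 0"
proof -
  have "S - cells {R} \<union> cells {R} = S"
    using assms(2) by blast
  then show ?thesis
    using uniform_state_swap[OF assms(1), of R "S - cells {R}" R' M] assms(3)
    by (auto simp: bond_apply_full_empty[OF assms(2,3)])
qed

lemma uniform_state_bond:
  assumes "inj pos" "R \<noteq> R'"
  shows "bond pos R R' *v uniform_state pos M = 0"
proof -
  have "(bond pos R R' *v uniform_state pos M) $ S = 0" for S
    using uniform_state_bond_full_empty[OF assms(1), of R S R' M] uniform_state_bond_full_empty[OF assms(1), of R' S R M]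
      bond_apply_eq_0[OF assms(2), of S pos "uniform_state pos M"] bond_commute[of pos R R'] by metis
  then show ?thesis
    by (simp add: vec_eq_iff)
qed

section \<open>Charge sectors\<close>

lemma sector_iff: "\<psi> \<in> sector pos N \<longleftrightarrow> (\<forall>S. card S \<noteq> N \<longrightarrow> \<psi> $ S = 0)"
  by (auto simp: sector_def vec_eq_iff total_num_apply)

lemma uniform_state_in_sector:
  assumes "inj pos"
  shows "uniform_state pos M \<in> sector pos (4 * M)"
  unfolding sector_iff using uniform_state_cells[OF assms] uniform_state_not_cells[OF assms] card_cells by metis

text \<open>A union of \<open>M\<close> cells has \<open>4 * M\<close> modes, so membership in
  another sector kills the amplitude there, which is \<open>a M\<close> up to sign.\<close>

lemma sector_coefficient_eq_0:
  fixes pos :: "'v::finite mode \<Rightarrow> nat"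
  assumes "inj pos" "(\<Sum>M\<le>CARD('v). a M *s uniform_state pos M) \<in> sector pos N" "M \<le> CARD('v)" "4 * M \<noteq> N"
  shows "a M = 0"
proof -
  obtain A :: "'v set" where A: "card A = M"
    using obtain_subset_with_card_n[OF assms(3)] by blast
  have "(\<Sum>M\<le>CARD('v). a M *s uniform_state pos M) $ cells A = 0"
    using sector_iff[THEN iffD1, OF assms(2), rule_format, of "cells A"] assms(4) A
    unfolding card_cells by blast
  then have "a M * qcoeff pos A = 0"
    unfolding sum_uniform_state_cells[OF assms(1)] A .
  then show ?thesis
    using quartets_eq_qcoeff(2)[OF assms(1), of A] by auto
qed

lemma subspace_zero_modes: "vec.subspace (zero_modes G pos U J)"
  by (simp add: vec.subspace_def zero_modes_def vec.add vec.scale)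

lemma subspace_sector: "vec.subspace (sector pos N)"
  by (simp add: vec.subspace_def sector_iff)

section \<open>Linear independence and dimension\<close>

lemma uniform_state_independent:
  fixes pos :: "'v::finite mode \<Rightarrow> nat"
  assumes "inj pos" "(\<Sum>M\<le>CARD('v). a M *s uniform_state pos M) = 0" "M \<le> CARD('v)"
  shows "a M = 0"
proof -
  obtain A :: "'v set" where "card A = M"
    using obtain_subset_with_card_n[OF assms(3)] by blast
  then show ?thesis
    using sum_uniform_state_cells[OF assms(1), of a A] quartets_eq_qcoeff(2)[OF assms(1), of A] assms(2) by auto
qed

lemma uniform_state_neq_0:
  fixes pos :: "'v::finite mode \<Rightarrow> nat"
  assumes "inj pos" "M \<le> CARD('v)"
  shows "uniform_state pos M \<noteq> 0"
proof
  assume "uniform_state pos M = 0"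
  then have "(\<Sum>K\<le>CARD('v). of_bool (K = M) *s uniform_state pos K) = 0"
    by (auto intro!: sum.neutral)
  from uniform_state_independent[OF assms(1) this assms(2)] show False
    by simp
qed

lemma dim_span_quartet_states:
  fixes pos :: "'v::finite mode \<Rightarrow> nat"
  assumes "inj pos"
  shows "vec.dim (vec.span {quartet_state pos M | M. M \<le> CARD('v)}) = CARD('v) + 1"
proof -
  have "\<exists>c. \<forall>M\<le>CARD('v). c M \<noteq> 0 \<and> quartet_state pos M = c M *s uniform_state pos M"
    using quartet_state_eq_uniform_state[OF assms] by metis
  then obtain c where c: "c M \<noteq> 0" "quartet_state pos M = c M *s uniform_state pos M" if "M \<le> CARD('v)" for M
    by blast
  \<comment> \<open>Needed to count the generators and to turn sums over the image into sums over
    \<open>M\<close>. Equal states would put one nonzero vector into two different sectors.\<close>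
  have inj: "inj_on (quartet_state pos) {..CARD('v)}"
  proof (rule inj_onI)
    fix K L assume KL: "K \<in> {..CARD('v)}" "L \<in> {..CARD('v)}" "quartet_state pos K = quartet_state pos L"
    have "uniform_state pos K \<in> sector pos (4 * L)"
    proof -
      have "uniform_state pos K = (c L / c K) *s uniform_state pos L"
        using KL c[of K] c[of L] by (simp add: vec_eq_iff field_simps)
      then show ?thesis
        using vec.subspace_scale[OF subspace_sector uniform_state_in_sector[OF assms]] by metis
    qed
    moreover obtain S where "uniform_state pos K $ S \<noteq> 0"
      using uniform_state_neq_0[OF assms, of K] KL(1) by (auto simp: vec_eq_iff)
    ultimately have "card S = 4 * K" "card S = 4 * L"
      using uniform_state_in_sector[OF assms, of K] unfolding sector_iff by blast+
    then show "K = L"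
      by simp
  qed
  have set: "{quartet_state pos M | M. M \<le> CARD('v)} = quartet_state pos ` {..CARD('v)}"
    by auto
  have "vec.independent (quartet_state pos ` {..CARD('v)})"
  proof (rule vec.independent_if_scalars_zero)
    fix f x assume f: "(\<Sum>x\<in>quartet_state pos ` {..CARD('v)}. f x *s x) = 0"
      and "x \<in> quartet_state pos ` {..CARD('v)}"
    then obtain M where M: "M \<le> CARD('v)" "x = quartet_state pos M"
      by auto
    have "(\<Sum>M\<le>CARD('v). (f (quartet_state pos M) * c M) *s uniform_state pos M)
        = (\<Sum>M\<le>CARD('v). f (quartet_state pos M) *s quartet_state pos M)"
      by (rule sum.cong) (simp_all add: c(2))
    also have "\<dots> = 0"
      using f by (simp only: sum.reindex[OF inj] o_def)
    finally have "(\<Sum>M\<le>CARD('v). (f (quartet_state pos M) * c M) *s uniform_state pos M) = 0" .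
    from uniform_state_independent[OF assms this M(1)] show "f x = 0"
      using c(1) M by simp
  qed simp
  then have "vec.dim (vec.span (quartet_state pos ` {..CARD('v)})) = card (quartet_state pos ` {..CARD('v)})"
    by (rule vec.dim_span_eq_card_independent)
  then show ?thesis
    unfolding set by (simp add: card_image[OF inj])
qed

theorem theorem1:
  fixes G :: "'v::finite pair_pre_digraph"
    and pos :: "'v mode \<Rightarrow> nat"
    and U J :: real
  assumes "pair_graph G"
    and "pverts G = UNIV"
    and "Digraph_Component.connected (with_proj G)"
    and "inj pos"
    and "U > 0" and "J > 0"
  shows "(\<forall>M \<le> CARD('v). quartet_state pos M \<noteq> 0 \<and>
            zero_modes G pos U J \<inter> sector pos (4 * M) = vec.span {quartet_state pos M}) \<and>
         zero_modes G pos U J = vec.span {quartet_state pos M | M. M \<le> CARD('v)} \<and>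
         vec.dim (zero_modes G pos U J) = CARD('v) + 1 \<and>
         (\<forall>\<epsilon> \<psi>. \<psi> \<noteq> 0 \<and> H_exact G pos U J *v \<psi> = \<epsilon> *s \<psi> \<longrightarrow> \<epsilon> \<in> \<real>\<^sub>\<ge>\<^sub>0) \<and>
         (\<forall>N. \<not> 4 dvd N \<longrightarrow> zero_modes G pos U J \<inter> sector pos N = {0})"
proof -
  interpret pair_graph G by fact
  have irrefl: "irrefl (parcs G)"
    using pair_no_loops by (fastforce simp: irrefl_def)
  \<comment> \<open>Connectedness refers to the underlying undirected graph; symmetry of the arcs
    turns it into directed reachability.\<close>
  have conn: "(x, y) \<in> (parcs G)\<^sup>*" for x y
  proof -
    have "strongly_connected (with_proj G)"
      using symmetric_connected_imp_strongly_connected[OF sym_arcs assms(3)] .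
    then have "x \<rightarrow>\<^sup>*\<^bsub>with_proj G\<^esub> y"
      using assms(2) by (auto simp: strongly_connected_def)
    then show ?thesis
      by (auto dest!: reachable_rtranclI simp: arcs_ends_conv)
  qed
  note zero = zero_mode_iff[OF irrefl assms(5,6), of pos]
  have uniform_state_zero: "uniform_state pos M \<in> zero_modes G pos U J" for M
    using irrefl by (auto simp: zero_modes_def zero uniform_state_Pcell[OF assms(4)] irrefl_def
        intro!: uniform_state_bond[OF assms(4)])
  have expansion: "\<exists>a. \<psi> = (\<Sum>M\<le>CARD('v). a M *s uniform_state pos M)" if "\<psi> \<in> zero_modes G pos U J" for \<psi>
  proof -
    have "(mat 1 - Pcell pos R) *v \<psi> = 0" for R
      using that assms(2) by (simp add: zero_modes_def zero)
    moreover have "R \<noteq> R' \<and> bond pos R R' *v \<psi> = 0" if "(R, R') \<in> parcs G" for R R'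
      using \<open>\<psi> \<in> zero_modes G pos U J\<close> that irrefl by (auto simp: zero_modes_def zero irrefl_def)
    ultimately show ?thesis
      using zero_mode_expansion[OF assms(4), of \<psi> "parcs G"] conn by metis
  qed
  have sec: "zero_modes G pos U J \<inter> sector pos (4 * M) = vec.span {quartet_state pos M}"
    and nonzero: "quartet_state pos M \<noteq> 0" and in_span: "uniform_state pos M \<in> vec.span {quartet_state pos M}"
    if M: "M \<le> CARD('v)" for M
  proof -
    obtain c where c: "c \<noteq> 0" "quartet_state pos M = c *s uniform_state pos M"
      using quartet_state_eq_uniform_state[OF assms(4) M] by blast
    then have u: "uniform_state pos M = (1 / c) *s quartet_state pos M"
      by simp
    then show in_span: "uniform_state pos M \<in> vec.span {quartet_state pos M}"
      by (metis vec.span_scale vec.span_base singletonI)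
    show "quartet_state pos M \<noteq> 0"
      using c uniform_state_neq_0[OF assms(4) M] by simp
    have "quartet_state pos M \<in> zero_modes G pos U J \<inter> sector pos (4 * M)"
      unfolding c(2)
      by (intro IntI vec.subspace_scale[OF subspace_zero_modes uniform_state_zero]
          vec.subspace_scale[OF subspace_sector uniform_state_in_sector[OF assms(4)]])
    then have "vec.span {quartet_state pos M} \<subseteq> zero_modes G pos U J \<inter> sector pos (4 * M)"
      by (intro vec.span_minimal vec.subspace_inter subspace_zero_modes subspace_sector) simp
    moreover have "\<psi> \<in> vec.span {quartet_state pos M}"
      if "\<psi> \<in> zero_modes G pos U J" "\<psi> \<in> sector pos (4 * M)" for \<psi>
    proof -
      obtain a where a: "\<psi> = (\<Sum>M\<le>CARD('v). a M *s uniform_state pos M)"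
        using expansion[OF \<open>\<psi> \<in> zero_modes G pos U J\<close>] by blast
      \<comment> \<open>The sector condition removes every coefficient except the one at
        \<open>M\<close>, leaving a one-dimensional space.\<close>
      have "a K = 0" if "K \<le> CARD('v)" "K \<noteq> M" for K
        using sector_coefficient_eq_0[OF assms(4)] \<open>\<psi> \<in> sector pos (4 * M)\<close> that unfolding a by simp
      then have "\<psi> = (\<Sum>K\<le>CARD('v). if K = M then a M *s uniform_state pos M else 0)"
        unfolding a by (intro sum.cong) auto
      also have "\<dots> = a M *s uniform_state pos M"
        using M by simp
      finally show ?thesis
        using in_span by (simp add: vec.span_scale)
    qed
    ultimately show "zero_modes G pos U J \<inter> sector pos (4 * M) = vec.span {quartet_state pos M}"
      by blast
  qed
  have all: "zero_modes G pos U J = vec.span {quartet_state pos M | M. M \<le> CARD('v)}"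
  proof
    show "zero_modes G pos U J \<subseteq> vec.span {quartet_state pos M | M. M \<le> CARD('v)}"
    proof
      fix \<psi> assume "\<psi> \<in> zero_modes G pos U J"
      from expansion[OF this] obtain a where a: "\<psi> = (\<Sum>M\<le>CARD('v). a M *s uniform_state pos M)"
        by blast
      have "vec.span {quartet_state pos M} \<subseteq> vec.span {quartet_state pos M | M. M \<le> CARD('v)}"
        if "M \<le> CARD('v)" for M
        using that by (intro vec.span_mono) auto
      then show "\<psi> \<in> vec.span {quartet_state pos M | M. M \<le> CARD('v)}"
        unfolding a using in_span by (intro vec.span_sum vec.span_scale) auto
    qed
    have "quartet_state pos M \<in> zero_modes G pos U J" if "M \<le> CARD('v)" for M
      using sec[OF that] vec.span_base[of "quartet_state pos M" "{quartet_state pos M}"] by blast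
    then show "vec.span {quartet_state pos M | M. M \<le> CARD('v)} \<subseteq> zero_modes G pos U J"
      by (intro vec.span_minimal subspace_zero_modes) auto
  qed
  have other: "zero_modes G pos U J \<inter> sector pos N = {0}" if "\<not> 4 dvd N" for N
  proof -
    have "\<psi> = 0" if "\<psi> \<in> zero_modes G pos U J" "\<psi> \<in> sector pos N" for \<psi>
    proof -
      obtain a where a: "\<psi> = (\<Sum>M\<le>CARD('v). a M *s uniform_state pos M)"
        using expansion[OF \<open>\<psi> \<in> zero_modes G pos U J\<close>] by blast
      \<comment> \<open>Every uniform state has electron number divisible by four, so no coefficient
        survives.\<close>
      have "a M = 0" if "M \<le> CARD('v)" for M
      proof (rule sector_coefficient_eq_0[OF assms(4) \<open>\<psi> \<in> sector pos N\<close>[unfolded a] that])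
        show "4 * M \<noteq> N"
          using \<open>\<not> 4 dvd N\<close> by auto
      qed
      then show ?thesis
        unfolding a by (intro sum.neutral) auto
    qed
    then show ?thesis
      using vec.subspace_0[OF subspace_zero_modes] vec.subspace_0[OF subspace_sector] by blast
  qed
  have dim: "vec.dim (zero_modes G pos U J) = CARD('v) + 1"
    unfolding all by (rule dim_span_quartet_states[OF assms(4)])
  have nonneg: "\<epsilon> \<in> \<real>\<^sub>\<ge>\<^sub>0" if "\<psi> \<noteq> 0" "H_exact G pos U J *v \<psi> = \<epsilon> *s \<psi>" for \<epsilon> \<psi>
    using H_eigenvalue_nonneg[OF irrefl _ _ that] assms(5,6) by simp
  show ?thesis
    by (intro conjI allI impI) (fact all dim | erule sec nonzero other | (elim conjE, rule nonneg, assumption+))+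
qed

end
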